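(* Let $a=2^s$ with $s\ge1$ an integer, let $q=2^a+1$ be a Fermat prime and $p$ a prime divisor of $2^a-1$. Let $S=-S\subseteq\mathbb{Z}_p^*$ and $U\subseteq\mathbb{Z}_p$. Then the clique number of $\Gamma(a,p,S,U)$ satisfies $\omega(\Gamma(a,p,S,U))\ge p$, with equality only when $p=2^{2^l}+1$ for some $0\le l\le s-1$.
   Context: A Fermat prime is a prime of the form $2^{2^s}+1$ with $s\ge0$ an integer. $\omega$ denotes the clique number. The Marušič-Scapellato graph $\Gamma(a,p,S,U)$ is defined as follows. Let $w$ be a primitive element of $\mathrm{GF}(2^a)$. The vertex set is $(\mathrm{GF}(2^a)\cup\{\infty\})\times\mathbb{Z}_p$. The neighbourhood of $(\infty,r)$ is $\{(\infty,r+s'):s'\in S\}\cup\{(x,r+u):x\in\mathrm{GF}(2^a),u\in U\}$. The neighbourhood of $(x,r)$ with $x\in\mathrm{GF}(2^a)$ is $\{(x,r+s'):s'\in S\}\cup\{(\infty,r-u):u\in U\}\cup\{(x+w^i,-r+u+2i):i\in\mathbb{Z}_{2^a-1},u\in U\}$. $S$ may be empty.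
   Formalization: The formal statement additionally assumes that U is nonempty; for S = U = ∅ the graph has no edges, so its clique number is 1 < p and the claim as written fails. *)

theory Defs
  imports
    "HOL-Library.Cardinality"
    "HOL-Library.Ramsey"
    "HOL-Computational_Algebra.Primes"
begin

text \<open>
  A primitive element of a finite field is a generator of its multiplicative group.
\<close>

definition primitive_element :: "'f::{finite,field} \<Rightarrow> bool" where
  "primitive_element w \<longleftrightarrow> w \<noteq> 0 \<and> (\<forall>x. x \<noteq> 0 \<longrightarrow> (\<exists>i::nat. x = w ^ i))"

text \<open>
  The elements of \<open>\<int>\<^sub>p\<close> are represented by the integers \<open>0, \<dots>, p - 1\<close>, and all
  arithmetic is followed by reduction modulo \<open>p\<close>. In \<open>'f option\<close>, \<open>None\<close> is the
  point \<open>\<infinity>\<close> and \<open>Some x\<close> is the field element \<open>x\<close>.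
\<close>

definition Zp :: "nat \<Rightarrow> int set" where
  "Zp p = {0..<int p}"

definition MS_vertices :: "nat \<Rightarrow> ('f::{finite,field} option \<times> int) set" where
  "MS_vertices p = UNIV \<times> Zp p"

text \<open>
  The exponent \<open>i\<close> ranges over the representatives \<open>0, \<dots>, 2 ^ a - 2\<close> of
  \<open>\<int>\<close> modulo \<open>2 ^ a - 1\<close>. The choice of representatives is immaterial if the field has
  \<open>2 ^ a\<close> elements and \<open>p\<close> divides \<open>2 ^ a - 1\<close>.
\<close>

fun MS_nbhd :: "'f::{finite,field} \<Rightarrow> nat \<Rightarrow> nat \<Rightarrow> int set \<Rightarrow> int set \<Rightarrow>
    'f option \<times> int \<Rightarrow> ('f option \<times> int) set" where
  "MS_nbhd w a p S U (None, r) =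
     {(None, (r + t) mod int p) | t. t \<in> S} \<union>
     {(Some x, (r + u) mod int p) | x u. u \<in> U}"
| "MS_nbhd w a p S U (Some x, r) =
     {(Some x, (r + t) mod int p) | t. t \<in> S} \<union>
     {(None, (r - u) mod int p) | u. u \<in> U} \<union>
     {(Some (x + w ^ i), (- r + u + 2 * int i) mod int p) | i u. i < 2 ^ a - 1 \<and> u \<in> U}"

text \<open>
  The adjacency relation given by \<open>MS_nbhd\<close> is symmetric when the field has \<open>2 ^ a\<close>
  elements and \<open>S = - S\<close>, so that passing to unordered pairs adds no adjacencies.
  \<open>S\<close> may be empty, but \<open>U\<close> is meant to be nonempty: for \<open>U = {}\<close> the graph is a disjoint union of
  \<open>2 ^ a + 1\<close> copies of a Cayley graph on \<open>\<int>\<^sub>p\<close>, without any edge if \<open>S = {}\<close> as well.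
\<close>

definition MS_edges :: "'f::{finite,field} \<Rightarrow> nat \<Rightarrow> nat \<Rightarrow> int set \<Rightarrow> int set \<Rightarrow>
    ('f option \<times> int) set set" where
  "MS_edges w a p S U = {{v, v'} | v v'. v \<in> MS_vertices p \<and> v' \<in> MS_nbhd w a p S U v}"

text \<open>The clique number of a graph with finite vertex set \<open>V\<close> and edge set \<open>E\<close>.\<close>

definition clique_number :: "'v set \<Rightarrow> 'v set set \<Rightarrow> nat" where
  "clique_number V E = Max {card C | C. C \<subseteq> V \<and> clique C E}"

definition MS_clique_number :: "'f::{finite,field} \<Rightarrow> nat \<Rightarrow> nat \<Rightarrow> int set \<Rightarrow> int set \<Rightarrow> nat" where
  "MS_clique_number w a p S U = clique_number (MS_vertices p) (MS_edges w a p S U)"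

end

theory Submission
  imports Defs
begin

(* A prime p dividing 2^(2^s) - 1 divides some Fermat number F = 2^(2^l) + 1 with l < s. The field
   has a subfield K of order F - 1, and since p divides (2^a - 1) / (F - 2), every nonzero element
   of K is a power of w whose exponent is divisible by p. So for u in U and 2 h = u modulo p, the
   vertices (x, h) with x in K, together with (infinity, h - u), form a clique of size F >= p. *)

section \<open>Divisibility among Fermat numbers\<close>

lemma Fermat_number_mult: "(2::nat) ^ 2 ^ Suc n - 1 = (2 ^ 2 ^ n + 1) * (2 ^ 2 ^ n - 1)"
  by (simp add: algebra_simps mult_2 power_add)

text \<open>Induction on \<open>s\<close>: a prime dividing the product in
  \<open>Fermat_number_mult\<close> divides one of the two factors. The descent ends at
  \<open>2 ^ 2 ^ 0 - 1 = 1\<close>, which no prime divides.\<close>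

lemma prime_dvd_Fermat_number:
  fixes p s :: nat
  assumes "prime p" "p dvd 2 ^ 2 ^ s - 1"
  obtains l where "l < s" "p dvd 2 ^ 2 ^ l + 1"
proof -
  have "\<exists>l<s. p dvd 2 ^ 2 ^ l + 1"
    using assms(2)
  proof (induction s)
    case 0
    with \<open>prime p\<close> show ?case by simp
  next
    case (Suc s)
    then have "p dvd 2 ^ 2 ^ s + 1 \<or> p dvd 2 ^ 2 ^ s - 1"
      using \<open>prime p\<close> unfolding Fermat_number_mult by (metis prime_dvd_multD)
    with Suc.IH show ?case
      using less_Suc_eq by blast
  qed
  with that show thesis by blast
qed

text \<open>The numbers \<open>2 ^ 2 ^ n - 1\<close> form a divisibility chain, and the product on
  the left is its member at \<open>Suc l\<close>.\<close>

lemma Fermat_number_mult_dvd: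
  fixes l s :: nat
  assumes "l < s"
  shows "((2::nat) ^ 2 ^ l + 1) * (2 ^ 2 ^ l - 1) dvd 2 ^ 2 ^ s - 1"
proof -
  have step: "2 ^ 2 ^ n - 1 dvd (2::nat) ^ 2 ^ Suc n - 1" for n
    unfolding Fermat_number_mult by (rule dvd_triv_right)
  have "(2::nat) ^ 2 ^ Suc l - 1 dvd 2 ^ 2 ^ s - 1"
    using Suc_leI[OF assms]
    by (induction rule: dec_induct) (rule dvd_refl, erule dvd_trans[OF _ step])
  then show ?thesis
    unfolding Fermat_number_mult .
qed

section \<open>Finite fields, primitive elements and a subfield\<close>

lemma finite_field_power_card_minus_1:
  fixes x :: "'f::{finite,field}"
  assumes "x \<noteq> 0"
  shows "x ^ (CARD('f) - 1) = 1"
proof -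
  \<comment> \<open>Multiplication by \<open>x\<close> permutes the nonzero elements; their product
    is nonzero and can be cancelled.\<close>
  have "(\<Prod>y\<in>UNIV-{0}. x * y) = (\<Prod>y\<in>UNIV-{0}. y)"
    by (rule prod.reindex_bij_witness[of _ "\<lambda>y. y / x" "\<lambda>y. x * y"]) (use assms in auto)
  then have "x ^ (CARD('f) - 1) * \<Prod>(UNIV-{0}) = \<Prod>(UNIV-{0})"
    by (simp add: prod.distrib)
  then show ?thesis by simp
qed

text \<open>The exponent \<open>CARD('f) - 1\<close> is odd, so that power of \<open>- 1\<close> is
  both \<open>- 1\<close> and \<open>1\<close>, whence \<open>1 + 1 = 0\<close>.\<close>

lemma CHAR_eq_2_if_even_card:
  assumes "even CARD('f::{finite,field})"
  shows "CHAR('f) = 2"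
proof -
  have "odd (CARD('f) - 1)"
    using assms zero_less_card_finite[where 'a = 'f] by (metis even_diff_nat even_Suc Suc_pred' One_nat_def)
  then have "(- 1 :: 'f) = 1"
    using finite_field_power_card_minus_1[of "- 1 :: 'f"] by simp
  then have "of_nat 2 = (0 :: 'f)"
    by (metis of_nat_numeral one_add_one add.left_inverse)
  then have "CHAR('f) dvd 2"
    using of_nat_eq_0_iff_char_dvd by blast
  then show ?thesis
    using CHAR_not_1[where 'a = 'f] by (metis One_nat_def two_is_prime_nat prime_nat_iff)
qed

text \<open>Exponents matter only modulo \<open>CARD('f) - 1\<close>, so those below this number
  already give all nonzero elements. A surjection between finite sets of equal size is
  injective.\<close>

lemma primitive_element_bij_betw:
  fixes w :: "'f::{finite,field}"
  assumes "primitive_element w"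
  shows "bij_betw (\<lambda>i. w ^ i) {..<CARD('f) - 1} (UNIV - {0})"
proof -
  let ?N = "CARD('f) - 1"
  have w: "w \<noteq> 0" and gen: "\<And>x. x \<noteq> 0 \<Longrightarrow> \<exists>i. x = w ^ i"
    using assms by (auto simp: primitive_element_def)
  have N: "?N > 0"
    using card_mono[of UNIV "{0, 1::'f}"] by simp
  have red: "w ^ i = w ^ (i mod ?N)" for i
  proof -
    have "w ^ i = (w ^ ?N) ^ (i div ?N) * w ^ (i mod ?N)"
      by (metis power_add power_mult mult_div_mod_eq)
    then show ?thesis
      using finite_field_power_card_minus_1[OF w] by simp
  qed
  have im: "(\<lambda>i. w ^ i) ` {..<?N} = UNIV - {0}"
  proof (intro equalityI subsetI)
    fix x :: 'f assume "x \<in> UNIV - {0}"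
    then obtain i where "x = w ^ i"
      using gen by blast
    then show "x \<in> (\<lambda>i. w ^ i) ` {..<?N}"
      using red[of i] N by auto
  qed (use w in auto)
  then have "inj_on (\<lambda>i. w ^ i) {..<?N}"
    by (intro eq_card_imp_inj_on) auto
  with im show ?thesis
    by (simp add: bij_betw_def)
qed

text \<open>The exponent reduced modulo \<open>CARD('f) - 1\<close> also gives
  \<open>1 = w ^ 0\<close>, so by injectivity it is \<open>0\<close>.\<close>

lemma primitive_element_power_eq_1D:
  fixes w :: "'f::{finite,field}"
  assumes "primitive_element w" "w ^ i = 1"
  shows "CARD('f) - 1 dvd i"
proof -
  let ?N = "CARD('f) - 1"
  have "?N > 0"
    using card_mono[of UNIV "{0, 1::'f}"] by simp
  have "w ^ i = (w ^ ?N) ^ (i div ?N) * w ^ (i mod ?N)"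
    by (metis power_add power_mult mult_div_mod_eq)
  moreover have "w \<noteq> 0"
    using assms(1) by (auto simp: primitive_element_def)
  ultimately have "w ^ (i mod ?N) = w ^ 0"
    using assms(2) finite_field_power_card_minus_1[of w] by simp
  then have "i mod ?N = 0"
    using bij_betw_imp_inj_on[OF primitive_element_bij_betw[OF assms(1)]] \<open>?N > 0\<close>
    by (elim inj_onD) auto
  then show ?thesis by auto
qed

text \<open>Here \<open>K\<close> is the subfield of order \<open>2 ^ k\<close>, realised as the fixed points of \<open>x \<mapsto> x ^ 2 ^ k\<close>.\<close>

lemma subfield_differences:
  fixes w :: "'f::{finite,field}"
  assumes "primitive_element w" "even CARD('f)" "0 < k" "CARD('f) - 1 = m * (2 ^ k - 1)"
  obtains K :: "'f set" where "2 ^ k \<le> card K"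
    "\<And>x y. x \<in> K \<Longrightarrow> y \<in> K \<Longrightarrow> x \<noteq> y \<Longrightarrow> \<exists>i<CARD('f) - 1. y - x = w ^ i \<and> m dvd i"
proof
  let ?N = "CARD('f) - 1" and ?Q = "2 ^ k :: nat"
  let ?K = "{x::'f. x ^ ?Q = x}"
  have char: "CHAR('f) = 2"
    using assms(2) by (rule CHAR_eq_2_if_even_card)
  have w: "w \<noteq> 0"
    using assms(1) by (auto simp: primitive_element_def)
  have bij: "bij_betw (\<lambda>i. w ^ i) {..<?N} (UNIV - {0})"
    using assms(1) by (rule primitive_element_bij_betw)
  have Q: "Suc (?Q - 1) = ?Q" "?Q > 1"
    using \<open>0 < k\<close> by (simp, intro one_less_power) simp_all
  have "?N > 0"
    using card_mono[of UNIV "{0, 1::'f}"] by simp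
  then have "m > 0"
    using assms(4) by (metis mult_0 not_gr_zero)
  \<comment> \<open>These are the powers of \<open>w ^ m\<close>, an element of order
    \<open>?Q - 1\<close>. With \<open>0\<close> they provide \<open>?Q\<close> fixed points; they
    are distinct because the exponents \<open>j * m\<close> stay below \<open>?N\<close>.\<close>
  let ?P = "(\<lambda>j. w ^ (j * m)) ` {..<?Q - 1}"
  have "inj_on (\<lambda>j. w ^ (j * m)) {..<?Q - 1}"
  proof (rule inj_onI)
    fix i j assume ij: "i \<in> {..<?Q - 1}" "j \<in> {..<?Q - 1}" "w ^ (i * m) = w ^ (j * m)"
    then have "i * m < ?N" "j * m < ?N"
      using \<open>m > 0\<close> unfolding assms(4) by (simp_all add: mult.commute)
    with ij(3) have "i * m = j * m"
      using bij_betw_imp_inj_on[OF bij] by (auto dest: inj_onD)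
    with \<open>m > 0\<close> show "i = j" by simp
  qed
  then have "card ?P = ?Q - 1"
    by (simp add: card_image)
  moreover have "0 \<notin> ?P"
    using w by auto
  ultimately have "card (insert 0 ?P) = ?Q"
    using Q by simp
  moreover have "insert 0 ?P \<subseteq> ?K"
  proof -
    have "(w ^ (j * m)) ^ ?Q = w ^ (j * m)" for j
    proof -
      have "(w ^ (j * m)) ^ ?Q = w ^ (j * m) * (w ^ (j * m)) ^ (?Q - 1)"
        by (metis Q(1) power_Suc)
      also have "(w ^ (j * m)) ^ (?Q - 1) = (w ^ ?N) ^ j"
        unfolding assms(4) by (simp add: mult_ac flip: power_mult)
      finally show ?thesis
        using finite_field_power_card_minus_1[OF w] by simp
    qed
    then show ?thesis by auto
  qed
  ultimately show "?Q \<le> card ?K"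
    by (metis card_mono finite)
  fix x y assume xy: "x \<in> ?K" "y \<in> ?K" "x \<noteq> y"
  \<comment> \<open>In characteristic 2 subtraction is addition, and raising to the power
    \<open>?Q\<close> of 2 is additive. Hence differences of fixed points are fixed points.\<close>
  have diff: "y - x = y + x"
    using char by (rule minus_CHAR_2)
  have "(y + x) ^ ?Q = y ^ ?Q + x ^ ?Q"
    by (rule freshmans_dream') (simp_all add: char)
  then have fixed: "(y - x) ^ ?Q = y - x"
    unfolding diff using xy by simp
  obtain i where i: "i < ?N" "y - x = w ^ i"
    using xy(3) bij_betw_imp_surj_on[OF bij] by (metis DiffI UNIV_I imageE lessThan_iff right_minus_eq singletonD)
  \<comment> \<open>Cancelling \<open>w ^ i\<close> leaves \<open>w ^ (i * (?Q - 1)) = 1\<close>, so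
    \<open>m * (?Q - 1)\<close> divides \<open>i * (?Q - 1)\<close>.\<close>
  have "w ^ i * w ^ (i * (?Q - 1)) = w ^ i * 1"
    using fixed Q(1) unfolding i(2) by (metis mult.right_neutral power_Suc power_mult)
  then have "?N dvd i * (?Q - 1)"
    using w by (intro primitive_element_power_eq_1D[OF assms(1)]) simp
  then have "m dvd i"
    using Q(2) unfolding assms(4) by simp
  with i show "\<exists>i<?N. y - x = w ^ i \<and> m dvd i" by blast
qed

section \<open>Cliques in the graph\<close>

lemma MS_edges_memI:
  assumes "v \<in> MS_vertices p" "v' \<in> MS_nbhd w a p S U v"
  shows "{v, v'} \<in> MS_edges w a p S U" "{v', v} \<in> MS_edges w a p S U"
  using assms unfolding MS_edges_def insert_commute[of v'] by blast+

lemma card_clique_le_MS_clique_number: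
  fixes w :: "'f::{finite,field}"
  assumes "C \<subseteq> MS_vertices p" "clique C (MS_edges w a p S U)"
  shows "card C \<le> MS_clique_number w a p S U"
proof -
  have "finite (MS_vertices p :: ('f option \<times> int) set)"
    by (simp add: MS_vertices_def Zp_def)
  then have "finite {card C |C. C \<subseteq> MS_vertices p \<and> clique C (MS_edges w a p S U)}"
    by simp
  then show ?thesis
    unfolding MS_clique_number_def clique_number_def using assms by (intro Max_ge) auto
qed

text \<open>Since \<open>p\<close> divides \<open>i\<close>, the shift \<open>2 * i\<close> vanishes
  in the second coordinate, and a step in the field along \<open>w ^ i\<close> acts there as the
  reflection \<open>r \<mapsto> u - r\<close>. All vertices are put on a level \<open>h\<close>
  fixed by it.\<close>

lemma Suc_card_le_MS_clique_number:
  fixes w :: "'f::{finite,field}"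
  assumes "odd p" "u \<in> U"
    and K: "\<And>x y. x \<in> K \<Longrightarrow> y \<in> K \<Longrightarrow> x \<noteq> y \<Longrightarrow> \<exists>i<2 ^ a - 1. y - x = w ^ i \<and> p dvd i"
  shows "Suc (card K) \<le> MS_clique_number w a p S U"
proof -
  have p: "int p > 0"
    using assms(1) by (simp add: odd_pos)
  \<comment> \<open>For odd \<open>p\<close> the number \<open>(p + 1) div 2\<close> is the inverse
    of 2 modulo \<open>p\<close>, so \<open>h\<close> is half of \<open>u\<close>.\<close>
  define h where "h = (u * ((int p + 1) div 2)) mod int p"
  have "int p dvd 2 * h - u"
  proof -
    have "2 * (u * ((int p + 1) div 2)) = u * (int p + 1)"
      using assms(1) by (auto elim!: oddE)
    then have "(2 * h) mod int p = (u + int p * u) mod int p"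
      unfolding h_def by (metis mod_mult_right_eq distrib_left mult.right_neutral add.commute mult.commute)
    then show ?thesis
      by (simp add: mod_eq_dvd_iff)
  qed
  have h: "h mod int p = h" "h \<in> Zp p"
    using p by (simp_all add: h_def Zp_def)
  let ?E = "MS_edges w a p S U"
  let ?inf = "(None, (h - u) mod int p)" and ?A = "(\<lambda>x. (Some x, h)) ` K"
  have inf: "?inf \<in> MS_vertices p" and A: "?A \<subseteq> MS_vertices p"
    using p h by (auto simp: MS_vertices_def Zp_def)
  have "clique ?A ?E"
    unfolding clique_def
  proof (intro ballI impI)
    fix v v' assume "v \<in> ?A" "v' \<in> ?A" "v \<noteq> v'"
    then obtain x y where xy: "v = (Some x, h)" "v' = (Some y, h)" "x \<in> K" "y \<in> K" "x \<noteq> y"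
      by auto
    then obtain i where i: "i < 2 ^ a - 1" "y - x = w ^ i" "p dvd i"
      using K by blast
    have "int p dvd (- h + u + 2 * int i) - h"
    proof -
      have "(- h + u + 2 * int i) - h = 2 * int i - (2 * h - u)" by simp
      then show ?thesis
        using \<open>int p dvd 2 * h - u\<close> i(3) by (metis dvd_diff dvd_mult int_dvd_int_iff)
    qed
    then have "(- h + u + 2 * int i) mod int p = h"
      using h(1) by (metis mod_eq_dvd_iff)
    moreover have "y = x + w ^ i"
      using i(2) by (simp add: algebra_simps)
    ultimately have "v' \<in> MS_nbhd w a p S U v"
      using i(1) assms(2) unfolding xy by auto
    then show "{v, v'} \<in> ?E"
      using A \<open>v \<in> ?A\<close> by (intro MS_edges_memI) auto
  qed
  moreover have "{?inf, v} \<in> ?E" "{v, ?inf} \<in> ?E" if v: "v \<in> ?A" for v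
  proof -
    \<comment> \<open>From \<open>None\<close> the label \<open>u\<close> leads to every field
      point, raising the level by \<open>u\<close>; starting at \<open>h - u\<close> it reaches
      level \<open>h\<close>.\<close>
    have "((h - u) mod int p + u) mod int p = h"
      using h(1) by (simp add: mod_add_left_eq)
    then have "v \<in> MS_nbhd w a p S U ?inf"
      using v assms(2) by force
    then show "{?inf, v} \<in> ?E" "{v, ?inf} \<in> ?E"
      using MS_edges_memI[OF inf] by blast+
  qed
  ultimately have "clique (insert ?inf ?A) ?E"
    by (auto simp: clique_def)
  moreover have "card (insert ?inf ?A) = Suc (card K)"
    by (subst card_insert_disjoint) (auto simp: card_image inj_on_def)
  ultimately show ?thesis
    using card_clique_le_MS_clique_number[of "insert ?inf ?A" p w a S U] inf A by simp
qed

section \<open>The bound and the case of equality\<close>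

theorem theorem5p6:
  fixes w :: "'f::{finite,field}"
    and a s p :: nat
    and S U :: "int set"
  assumes "s \<ge> 1"
    and "a = 2 ^ s"
    and "prime (2 ^ a + 1 :: nat)"
    and "CARD('f) = 2 ^ a"
    and "primitive_element w"
    and "prime p"
    and "p dvd 2 ^ a - 1"
    and "S \<subseteq> Zp p - {0}"
    and "(\<lambda>t. (- t) mod int p) ` S = S"
    and "U \<subseteq> Zp p"
    and "U \<noteq> {}"
  shows "MS_clique_number w a p S U \<ge> p \<and>
    (MS_clique_number w a p S U = p \<longrightarrow> (\<exists>l::nat. l \<le> s - 1 \<and> p = 2 ^ 2 ^ l + 1))"
proof -
  obtain l where l: "l < s" "p dvd 2 ^ 2 ^ l + 1"
    using prime_dvd_Fermat_number assms(2,6,7) by blast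
  have N: "CARD('f) - 1 = 2 ^ a - 1"
    using assms(4) by simp
  obtain t where "(2::nat) ^ a - 1 = (2 ^ 2 ^ l + 1) * (2 ^ 2 ^ l - 1) * t"
    using Fermat_number_mult_dvd[OF l(1)] assms(2) by (metis dvdE)
  \<comment> \<open>The regrouping makes the cofactor of \<open>2 ^ 2 ^ l - 1\<close> a multiple of
    \<open>2 ^ 2 ^ l + 1\<close>, hence of \<open>p\<close>.\<close>
  then have m: "CARD('f) - 1 = (2 ^ 2 ^ l + 1) * t * (2 ^ 2 ^ l - 1)"
    unfolding N by (simp only: mult_ac)
  have "a > 0"
    using assms(2) by simp
  then have "even CARD('f)"
    using assms(4) by simp
  then obtain K :: "'f set" where K: "2 ^ 2 ^ l \<le> card K"
    "\<And>x y. x \<in> K \<Longrightarrow> y \<in> K \<Longrightarrow> x \<noteq> y \<Longrightarrow>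
      \<exists>i<CARD('f) - 1. y - x = w ^ i \<and> (2 ^ 2 ^ l + 1) * t dvd i"
    using subfield_differences[OF assms(5) _ _ m] by auto
  obtain u where "u \<in> U"
    using assms(11) by blast
  have "odd ((2::nat) ^ a - 1)"
    using \<open>a > 0\<close> by simp
  then have "odd p"
    using assms(7) dvd_trans by blast
  have "Suc (card K) \<le> MS_clique_number w a p S U"
  proof (rule Suc_card_le_MS_clique_number[OF \<open>odd p\<close> \<open>u \<in> U\<close>])
    fix x y assume "x \<in> K" "y \<in> K" "x \<noteq> y"
    then show "\<exists>i<2 ^ a - 1. y - x = w ^ i \<and> p dvd i"
      using K(2) l(2) unfolding N by (meson dvd_mult2 dvd_trans)
  qed
  with K(1) have F: "2 ^ 2 ^ l + 1 \<le> MS_clique_number w a p S U"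
    by linarith
  \<comment> \<open>The Fermat number lies between \<open>p\<close> and the clique number, so
    equality of these two forces \<open>p\<close> to be that Fermat number.\<close>
  have "p \<le> 2 ^ 2 ^ l + 1"
    using l(2) by (rule dvd_imp_le) simp
  moreover have "l \<le> s - 1"
    using l(1) by simp
  ultimately show ?thesis
    using F by (metis le_antisym le_trans)
qed

end
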